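(* Let $D\subset\mathbb{C}^N$ and $G\subset\mathbb{C}^M$ be domains, where $N,M\ge1$, and let $\mathcal{U}$ be a family of continuous plurisubharmonic functions on $D\times G$. Suppose that: (i) $\mathcal{U}$ is locally uniformly bounded above on $D\times\{w\}$, for each $w\in G$; (ii) $\mathcal{U}$ is locally uniformly bounded above on $\{z\}\times G$, for each $z\in D$. Then $\mathcal{U}$ is locally uniformly bounded above on $D\times G$.
   Context: A domain is a connected open set. A function $u:\Omega\to[-\infty,\infty)$ on an open set $\Omega\subset\mathbb{C}^N$ is plurisubharmonic if it is upper semicontinuous and its restriction to $\Omega\cap L$ is subharmonic for every complex line $L$. A family $\mathcal{U}$ is locally uniformly bounded above on a set $S$ (such as $D\times\{w\}$, $\{z\}\times G$ or $D\times G$) if for every compact subset $C$ of $S$ there is a constant $c$ with $u\le c$ on $C$ for all $u\in\mathcal{U}$. *)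

theory Defs
  imports "HOL-Analysis.Analysis"
begin

definition usc_on :: "'a::topological_space set \<Rightarrow> ('a \<Rightarrow> ereal) \<Rightarrow> bool" where
  "usc_on S u \<longleftrightarrow> (\<forall>x\<in>S. \<forall>c. u x < c \<longrightarrow> (\<forall>\<^sub>F y in at x within S. u y < c))"

text \<open>Harmonic function on an open disc: locally (equivalently, on a disc) the real part
  of a holomorphic function.\<close>
definition harmonic_on_ball :: "(complex \<Rightarrow> real) \<Rightarrow> complex \<Rightarrow> real \<Rightarrow> bool" where
  "harmonic_on_ball h a r \<longleftrightarrow>
     (\<exists>f. f holomorphic_on ball a r \<and> (\<forall>z\<in>ball a r. h z = Re (f z)))"

definition subharmonic_on :: "complex set \<Rightarrow> (complex \<Rightarrow> ereal) \<Rightarrow> bool" where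
  "subharmonic_on U v \<longleftrightarrow>
     usc_on U v \<and> (\<forall>z\<in>U. v z \<noteq> \<infinity>) \<and>
     (\<forall>a r h. r > 0 \<longrightarrow> cball a r \<subseteq> U \<longrightarrow> continuous_on (cball a r) h \<longrightarrow>
        harmonic_on_ball h a r \<longrightarrow> (\<forall>z\<in>sphere a r. v z \<le> ereal (h z)) \<longrightarrow>
        (\<forall>z\<in>cball a r. v z \<le> ereal (h z)))"

definition cline_pt ::
  "((complex^'n) \<times> (complex^'m)) \<Rightarrow> ((complex^'n) \<times> (complex^'m)) \<Rightarrow> complex \<Rightarrow> ((complex^'n) \<times> (complex^'m))" where
  "cline_pt p q t = (fst p + t *s fst q, snd p + t *s snd q)"

definition psh_on :: "((complex^'n) \<times> (complex^'m)) set \<Rightarrow> ((complex^'n) \<times> (complex^'m) \<Rightarrow> ereal) \<Rightarrow> bool" where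
  "psh_on \<Omega> u \<longleftrightarrow> usc_on \<Omega> u \<and> (\<forall>x\<in>\<Omega>. u x \<noteq> \<infinity>) \<and>
     (\<forall>p q. q \<noteq> 0 \<longrightarrow>
        subharmonic_on {t. cline_pt p q t \<in> \<Omega>} (\<lambda>t. u (cline_pt p q t)))"

definition loc_unif_bdd_above :: "('a \<Rightarrow> ereal) set \<Rightarrow> 'a::topological_space set \<Rightarrow> bool" where
  "loc_unif_bdd_above \<U> S \<longleftrightarrow>
     (\<forall>C. compact C \<longrightarrow> C \<subseteq> S \<longrightarrow> (\<exists>c::real. \<forall>u\<in>\<U>. \<forall>x\<in>C. u x \<le> ereal c))"

end

theory Submission
  imports Defs "HOL-Complex_Analysis.Complex_Analysis"
begin

text \<open>By Baire's theorem and (ii), the family is bounded on some product of a small ball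
  of radius \<open>r\<close> around a point \<open>a\<close> near \<open>z0\<close> with a polydisc in \<open>G\<close>. The ball is then enlarged
  to a radius independent of \<open>r\<close>, treating one coordinate \<open>t\<close> of \<open>w\<close> at a time,
  by Hartogs' argument: by (i), the family is bounded by one constant on the large ball for all \<open>t\<close> in
  the unit circle outside a set of small measure. Given a member \<open>u\<close> of the family, let \<open>f\<close> be
  holomorphic with \<open>Re f \<ge> 0\<close> on the disc, \<open>Re f \<ge> 1\<close> on the exceptional set of \<open>u\<close>, and \<open>Re f\<close>
  small on the half disc. Then the analytic disc \<open>t \<mapsto> (a + exp (- L f t) \<zeta>, t)\<close> with \<open>L = ln (R / r)\<close>
  has its boundary where \<open>u\<close> is bounded by the constant, and the maximum principle carries this bound
  over to its interior. Since plurisubharmonicity is defined by complex lines only, the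
  maximum principle on non-linear discs is obtained by doubling the variables.\<close>

section \<open>Complex scalars on vectors and pairs of vectors\<close>

lemma norm_vector_smult: "norm (c *s x) = norm c * norm (x :: complex^'n)"
  by (simp add: norm_vec_def norm_mult L2_set_right_distrib)

definition csc :: "complex \<Rightarrow> (complex^'n) \<times> (complex^'m) \<Rightarrow> (complex^'n) \<times> (complex^'m)" where
  "csc c p = (c *s fst p, c *s snd p)"

lemma norm_csc: "norm (csc c p) = norm c * norm p"
  by (simp add: csc_def norm_Pair norm_vector_smult power_mult_distrib real_sqrt_mult
      flip: distrib_left) (simp add: norm_prod_def)

lemma csc_add: "csc (c + d) p = csc c p + csc d p"
  by (simp add: csc_def vector_sadd_rdistrib)

lemma vector_smult_of_real: "(of_real r * c) *s x = r *\<^sub>R (c *s (x :: complex^'n))"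
  unfolding vec_eq_iff vector_smult_component vector_scaleR_component
  by (simp add: scaleR_conv_of_real)

lemma csc_scaleR: "csc (of_real r * c) p = r *\<^sub>R csc c p"
  by (simp add: csc_def vector_smult_of_real)

lemma cline_pt_csc: "cline_pt p q t = p + csc t q"
  by (simp add: cline_pt_def csc_def prod_eq_iff)

lemma continuous_cline_pt: "continuous_on S (cline_pt p q)"
proof -
  have "dist (cline_pt p q s) (cline_pt p q t) = norm q * dist s t" for s t
    using norm_csc[of "s - t" q] csc_add[of "s - t" t q]
    by (simp add: cline_pt_csc dist_norm mult.commute)
  then have "(norm q)-lipschitz_on S (cline_pt p q)"
    by (intro lipschitz_onI) auto
  then show ?thesis by (rule lipschitz_on_continuous_on)
qed

text \<open>A real-linear functional of a complex variable \<open>t\<close> is the real part of a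
  complex multiple of \<open>t\<close>. Used with \<open>t\<^sup>2\<close> in place of
  \<open>t\<close>, this makes the second-order term of a disc harmonic.\<close>

lemma inner_csc_Re:
  obtains c where "\<And>t. d \<bullet> csc t q = Re (c * t)"
proof
  fix t
  have "csc t q = Re t *\<^sub>R csc 1 q + Im t *\<^sub>R csc \<i> q"
    using csc_add[of "of_real (Re t) * 1" "of_real (Im t) * \<i>" q]
      csc_scaleR[of "Re t" 1 q] csc_scaleR[of "Im t" \<i> q] complex_eq[of t]
    by (simp add: mult.commute)
  then show "d \<bullet> csc t q = Re (Complex (d \<bullet> csc 1 q) (- (d \<bullet> csc \<i> q)) * t)"
    by (simp add: inner_add_right)
qed

section \<open>The maximum principle on analytic discs\<close>

text \<open>Taylor's formula, with the third derivative bounded on a closed disc. The cubic error is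
  what the maximum principle below can absorb, its gain being of second order.\<close>

lemma holomorphic_second_order_expansion:
  assumes "\<phi> holomorphic_on S" "open S" "s \<in> S"
  obtains c1 c2 C e where "e > 0" "C \<ge> 0"
    "\<And>t. norm t < e \<Longrightarrow> norm (\<phi> (s + t) - (\<phi> s + c1 * t + c2 * t\<^sup>2)) \<le> C * norm t ^ 3"
proof -
  obtain e where e: "e > 0" "cball s e \<subseteq> S"
    using assms open_contains_cball by blast
  have hol: "(deriv ^^ i) \<phi> holomorphic_on S" for i
    using holomorphic_higher_deriv assms by blast
  have "bounded ((deriv ^^ 3) \<phi> ` cball s e)"
    by (intro compact_imp_bounded compact_continuous_image compact_cball)
      (meson hol e holomorphic_on_imp_continuous_on continuous_on_subset)
  then obtain B where B: "B > 0" "\<And>x. x \<in> cball s e \<Longrightarrow> norm ((deriv ^^ 3) \<phi> x) \<le> B"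
    by (auto simp: bounded_pos)
  have d: "((deriv ^^ i) \<phi> has_field_derivative (deriv ^^ Suc i) \<phi> x) (at x within cball s e)"
    if "x \<in> cball s e" for i x
    using holomorphic_derivI[OF hol \<open>open S\<close>, of x i] that e
    by (auto intro: has_field_derivative_at_within)
  show ?thesis
  proof (rule that[of e "B / 2" "deriv \<phi> s" "(deriv ^^ 2) \<phi> s / 2"])
    fix t :: complex assume t: "norm t < e"
    then have "s + t \<in> cball s e" by (simp add: dist_norm)
    then have "norm ((deriv ^^ 0) \<phi> (s + t) -
        (\<Sum>i\<le>2. (deriv ^^ i) \<phi> s * (s + t - s) ^ i / fact i)) \<le> B * norm (s + t - s) ^ Suc 2 / fact 2"
      using e(1) B(2) d by (intro complex_Taylor[where S="cball s e"]) (auto simp: numeral_3_eq_3 numeral_2_eq_2)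
    then show "norm (\<phi> (s + t) - (\<phi> s + deriv \<phi> s * t + (deriv ^^ 2) \<phi> s / 2 * t\<^sup>2)) \<le> B / 2 * norm t ^ 3"
      by (simp add: numeral_2_eq_2 numeral_3_eq_3)
  qed (use e B in auto)
qed

text \<open>If the bound failed inside the disc, a penalised maximum over pairs of a parameter and a
  point near the disc would give a complex line on which \<open>u\<close> violates comparison with a
  harmonic function. Holomorphy of \<open>\<gamma>\<close> enters only through
  \<open>expansion\<close>, where \<open>g1 \<noteq> 0\<close> makes the tangent span a
  line.\<close>

lemma psh_disc_max_principle:
  fixes u :: "(complex^'n) \<times> (complex^'m) \<Rightarrow> ereal"
    and \<gamma> :: "complex \<Rightarrow> (complex^'n) \<times> (complex^'m)"
  assumes "open \<Omega>" and cont_u: "continuous_on \<Omega> u" and psh: "psh_on \<Omega> u"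
    and cont: "continuous_on (cball 0 1) \<gamma>" and sub: "\<gamma> ` cball 0 1 \<subseteq> \<Omega>"
    and expansion: "\<And>s. s \<in> ball 0 1 \<Longrightarrow> \<exists>g1 g2 C e. e > 0 \<and> C \<ge> 0 \<and> g1 \<noteq> 0 \<and>
       (\<forall>t. norm t < e \<longrightarrow> norm (\<gamma> (s + t) - (\<gamma> s + csc t g1 + csc (t\<^sup>2) g2)) \<le> C * norm t ^ 3)"
    and bd: "\<And>t. t \<in> sphere 0 1 \<Longrightarrow> u (\<gamma> t) \<le> ereal k"
    and t1: "t1 \<in> cball 0 1"
  shows "u (\<gamma> t1) \<le> ereal k"
proof (rule ccontr)
  assume "\<not> u (\<gamma> t1) \<le> ereal k"
  \<comment> \<open>Truncating \<open>u\<close> from below at \<open>k\<close> removes the value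
    minus infinity, so that \<open>v\<close> is real and continuous; the truncation turns out to be
    inactive at the point \<open>q0\<close> found later.\<close>
  define v where "v q = real_of_ereal (max (u q) (ereal k))" for q
  have fin: "\<bar>max (u q) (ereal k)\<bar> \<noteq> \<infinity>" if "q \<in> \<Omega>" for q
    using psh that unfolding psh_on_def by (cases "u q") (auto simp: max_def)
  have v: "ereal (v q) = max (u q) (ereal k)" if "q \<in> \<Omega>" for q
    using fin[OF that] by (simp add: v_def ereal_real)
  have uv: "u q \<le> ereal (v q)" and kv: "k \<le> v q" if "q \<in> \<Omega>" for q
    using v[OF that] by (auto simp flip: ereal_less_eq(3))
  have cont_v: "continuous_on \<Omega> v"
  proof -
    have "continuous_on \<Omega> (\<lambda>q. max (u q) (ereal k))"
      using cont_u by (intro continuous_on_max continuous_on_const)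
    then have "continuous_on \<Omega> (\<lambda>q. ereal (v q))"
      using v by (simp cong: continuous_on_cong)
    then show ?thesis using continuous_on_iff_real[of \<Omega> v] by (simp add: o_def)
  qed
  have \<gamma>t1: "\<gamma> t1 \<in> \<Omega>" using sub t1 by auto
  have "v (\<gamma> t1) > k"
    using v[OF \<gamma>t1] \<open>\<not> u (\<gamma> t1) \<le> ereal k\<close> by (metis ereal_less_eq(3) kv[OF \<gamma>t1] linorder_not_le max.absorb2 max.cobounded1 order_antisym_conv)
  \<comment> \<open>The excess over \<open>k\<close> is \<open>3 * \<delta>\<close>. The bonus
    \<open>\<delta> * (norm t)\<^sup>2\<close> used below is at most \<open>\<delta>\<close> on the
    disc, so a definite excess survives at the maximum.\<close>
  define \<delta> where "\<delta> = (v (\<gamma> t1) - k) / 3"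
  have \<delta>: "\<delta> > 0" "v (\<gamma> t1) > k + 2 * \<delta>"
    using \<open>v (\<gamma> t1) > k\<close> by (auto simp: \<delta>_def field_simps)
  have comp: "compact (\<gamma> ` cball 0 1)" "\<gamma> ` cball 0 1 \<noteq> {}"
    using cont by (auto intro: compact_continuous_image)
  obtain d where d: "d > 0" "{x. infdist x (\<gamma> ` cball 0 1) \<le> d} \<subseteq> \<Omega>"
    using compact_in_open_separated[OF comp(2,1) \<open>open \<Omega>\<close> sub] by blast
  define K where "K = {x. infdist x (\<gamma> ` cball 0 1) \<le> d}"
  have K: "compact K" "K \<subseteq> \<Omega>"
    unfolding K_def using compact_infdist_le[OF comp(2,1)] d by auto
  have memK: "q \<in> K" if "dist q (\<gamma> t) \<le> d" "t \<in> cball 0 1" for q t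
    using infdist_le[of "\<gamma> t" "\<gamma> ` cball 0 1" q] that by (auto simp: K_def)
  have \<gamma>K: "\<gamma> t \<in> K" if "t \<in> cball 0 1" for t
    using memK[of "\<gamma> t" t] that d by simp
  have cont_vK: "continuous_on K v" using cont_v K continuous_on_subset by blast
  have "bounded (v ` K)"
    using K cont_vK by (intro compact_imp_bounded compact_continuous_image)
  then obtain M where M: "\<And>q. q \<in> K \<Longrightarrow> v q \<le> M"
    by (auto simp: bounded_real intro: order_trans[OF abs_ge_self])
  have Mk: "M - k > 2 * \<delta>" using M[OF \<gamma>K[OF t1]] \<delta> by linarith
  obtain \<eta> where \<eta>: "\<eta> > 0" "\<And>x y. x \<in> K \<Longrightarrow> y \<in> K \<Longrightarrow> dist x y < \<eta> \<Longrightarrow> dist (v x) (v y) < \<delta> / 2"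
    using compact_uniformly_continuous[OF cont_vK K(1)] \<delta>(1) unfolding uniformly_continuous_on_def
    by (metis half_gt_zero)
  define \<beta> where "\<beta> = min d \<eta>"
  have \<beta>: "\<beta> > 0" using d \<eta> by (simp add: \<beta>_def)
  \<comment> \<open>The penalty at distance \<open>\<beta>\<close> equals \<open>M - k\<close>, the
    largest possible excess of \<open>v\<close>. Hence a maximum has \<open>q0\<close> within
    \<open>\<beta>\<close> of the disc: inside the collar \<open>K\<close>, and so close that
    \<open>v\<close> varies by less than \<open>\<delta> / 2\<close>.\<close>
  define A where "A = (M - k) / \<beta>\<^sup>2"
  have A: "A > 0" using \<beta> Mk \<delta> by (simp add: A_def)
  txt \<open>At a maximum \<open>(t0, q0)\<close> of the penalised functional \<open>\<Phi>\<close>, moving \<open>t\<close> along the disc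
    and \<open>q\<close> along its tangent direction shows that, on the complex line through \<open>q0\<close>,
    \<open>u\<close> lies below a harmonic quadratic polynomial minus \<open>\<delta> \<bar>t\<bar>\<^sup>2\<close> up to cubic order: the
    second-order term of the disc only contributes a harmonic term.\<close>
  define \<Phi> where "\<Phi> = (\<lambda>(t, q). v q + \<delta> * (norm t)\<^sup>2 - A * (norm (\<gamma> t - q))\<^sup>2)"
  have "continuous_on (cball 0 1 \<times> K) \<Phi>"
    unfolding \<Phi>_def case_prod_unfold
    by (intro continuous_intros continuous_on_compose2[OF cont_vK] continuous_on_compose2[OF cont]) auto
  moreover have "compact (cball (0::complex) 1 \<times> K)" "cball (0::complex) 1 \<times> K \<noteq> {}"
    using K \<gamma>K t1 by (auto intro: compact_Times)
  ultimately obtain t0 q0 where tq: "t0 \<in> cball 0 1" "q0 \<in> K"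
    and max: "\<And>t q. t \<in> cball 0 1 \<Longrightarrow> q \<in> K \<Longrightarrow> \<Phi> (t, q) \<le> \<Phi> (t0, q0)"
    using continuous_attains_sup[of "cball 0 1 \<times> K" \<Phi>] by fastforce
  have "\<Phi> (t1, \<gamma> t1) \<ge> v (\<gamma> t1)" using \<delta> by (simp add: \<Phi>_def)
  then have big: "v q0 + \<delta> * (norm t0)\<^sup>2 - A * (norm (\<gamma> t0 - q0))\<^sup>2 > k + 2 * \<delta>"
    using max[OF t1 \<gamma>K[OF t1]] \<delta>(2) unfolding \<Phi>_def by simp
  have "\<delta> * (norm t0)\<^sup>2 \<le> \<delta>"
    using tq \<delta> by (simp add: power_le_one)
  moreover have "A * (norm (\<gamma> t0 - q0))\<^sup>2 \<ge> 0" using A by simp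
  ultimately have An: "A * (norm (\<gamma> t0 - q0))\<^sup>2 < M - k" and vq0: "v q0 > k + \<delta>"
    using big M[OF tq(2)] \<delta>(1) by linarith+
  have "A * \<beta>\<^sup>2 = M - k" using \<beta> by (simp add: A_def)
  with An have "A * (norm (\<gamma> t0 - q0))\<^sup>2 < A * \<beta>\<^sup>2" by simp
  then have "(norm (\<gamma> t0 - q0))\<^sup>2 < \<beta>\<^sup>2"
    using A by simp
  then have close: "norm (\<gamma> t0 - q0) < \<beta>" using \<beta> by (simp add: power2_less_imp_less)
  \<comment> \<open>On the boundary \<open>v\<close> equals \<open>k\<close>, so closeness would
    force \<open>v q0 < k + \<delta> / 2\<close>.\<close>
  have "t0 \<notin> sphere 0 1"
  proof
    assume "t0 \<in> sphere 0 1"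
    then have "v (\<gamma> t0) = k"
      using v[of "\<gamma> t0"] bd[of t0] K \<gamma>K[OF tq(1)] by (auto simp: max_def split: if_splits)
    moreover have "dist (v q0) (v (\<gamma> t0)) < \<delta> / 2"
      using \<eta>(2)[OF tq(2) \<gamma>K[OF tq(1)]] close by (simp add: \<beta>_def dist_norm norm_minus_commute)
    ultimately show False using vq0 \<delta> by (simp add: dist_real_def)
  qed
  then have t0: "norm t0 < 1" using tq by (auto simp: sphere_def)
  have uq0: "u q0 = ereal (v q0)"
    using v[of q0] vq0 \<delta> K tq by (auto simp: max_def split: if_splits)
  obtain g1 g2 C e where g: "e > 0" "C \<ge> 0" "g1 \<noteq> 0"
    and ex: "\<And>t. norm t < e \<Longrightarrow> norm (\<gamma> (t0 + t) - (\<gamma> t0 + csc t g1 + csc (t\<^sup>2) g2)) \<le> C * norm t ^ 3"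
  proof -
    have "t0 \<in> ball 0 1" using t0 by simp
    from expansion[OF this] show ?thesis using that by blast
  qed
  obtain c where c: "\<And>t. (\<gamma> t0 - q0) \<bullet> csc t g2 = Re (c * t)"
    using inner_csc_Re by blast
  \<comment> \<open>Collects the cubic errors in the squared distance: the first summand comes from
    the inner product with the Taylor remainder, the second from the square of all terms beyond
    first order, using \<open>\<rho> \<le> 1\<close>.\<close>
  define C' where "C' = 2 * \<beta> * C + (norm g2 + C)\<^sup>2"
  have C': "C' \<ge> 0" using \<beta> g by (simp add: C'_def)
  \<comment> \<open>In order, the four bounds keep the expansion valid, \<open>t0 + t\<close> in the
    unit disc, \<open>q0 + csc t g1\<close> in \<open>K\<close>, and the cubic error below half of
    \<open>\<delta> * \<rho>\<^sup>2\<close>. The added ones keep the denominators positive.\<close>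
  define m where "m = Min {e, 1 - norm t0, (d - norm (\<gamma> t0 - q0)) / (norm g1 + 1), \<delta> / (2 * (A * C' + 1))}"
  have nonneg: "A * C' \<ge> 0" using A C' by simp
  have "m > 0"
    unfolding m_def using g t0 close nonneg \<delta>
    by (auto simp: \<beta>_def intro!: divide_pos_pos add_nonneg_pos)
  define \<rho> where "\<rho> = m / 2"
  have \<rho>: "\<rho> > 0" "\<rho> < m" using \<open>m > 0\<close> by (auto simp: \<rho>_def)
  then have \<rho>1: "\<rho> < e" "\<rho> < 1 - norm t0" "\<rho> < (d - norm (\<gamma> t0 - q0)) / (norm g1 + 1)"
    "\<rho> < \<delta> / (2 * (A * C' + 1))"
    by (auto simp: m_def)
  have \<rho>2: "\<rho> * (norm g1 + 1) < d - norm (\<gamma> t0 - q0)" "\<rho> * (2 * (A * C' + 1)) < \<delta>"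
    using \<rho>1(3,4) nonneg by (auto simp: pos_less_divide_eq add_nonneg_pos)
  have inK: "q0 + csc t g1 \<in> K" if "norm t \<le> \<rho>" for t
  proof (rule memK[OF _ tq(1)])
    have "norm (csc t g1) \<le> \<rho> * norm g1"
      using that by (simp add: norm_csc mult_right_mono)
    also have "\<dots> \<le> \<rho> * (norm g1 + 1)" using \<rho> by simp
    finally have "norm (csc t g1) \<le> d - norm (\<gamma> t0 - q0)" using \<rho>2 by linarith
    then show "dist (q0 + csc t g1) (\<gamma> t0) \<le> d"
      using norm_triangle_ineq4[of "csc t g1" "\<gamma> t0 - q0"] by (simp add: dist_norm algebra_simps)
  qed
  \<comment> \<open>The growth of \<open>\<delta> * (norm t)\<^sup>2\<close> yields a gain of
    \<open>\<delta> * \<rho>\<^sup>2\<close>, of which half pays for the cubic error. The other half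
    remains in \<open>H 0\<close>, so that comparison at the centre of the line contradicts the
    value of \<open>u\<close> at \<open>q0\<close>.\<close>
  define H where "H t = of_real (v q0 - \<delta> * \<rho>\<^sup>2 / 2) - of_real (2 * \<delta>) * cnj t0 * t + of_real (2 * A) * c * t\<^sup>2" for t
  have bound: "u (cline_pt q0 g1 t) \<le> ereal (Re (H t))" if "t \<in> sphere 0 \<rho>" for t
  proof -
    have nt: "norm t = \<rho>" using that by simp
    define r where "r = \<gamma> (t0 + t) - (\<gamma> t0 + csc t g1 + csc (t\<^sup>2) g2)"
    have r: "norm r \<le> C * \<rho> ^ 3" using ex[of t] nt \<rho>1 by (simp add: r_def)
    define y where "y = csc (t\<^sup>2) g2 + r"
    have \<rho>le: "\<rho> \<le> 1" using \<rho>1(2) norm_ge_zero[of t0] by linarith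
    have "norm y \<le> norm g2 * \<rho>\<^sup>2 + C * \<rho> ^ 3"
      unfolding y_def using norm_triangle_ineq[of "csc (t\<^sup>2) g2" r] r nt
      by (simp add: norm_csc norm_power mult.commute)
    also have "\<dots> \<le> norm g2 * \<rho>\<^sup>2 + C * \<rho>\<^sup>2"
      using \<rho> \<rho>le g by (intro add_left_mono mult_left_mono power_decreasing) auto
    finally have "(norm y)\<^sup>2 \<le> ((norm g2 + C) * \<rho>\<^sup>2)\<^sup>2"
      by (intro power_mono) (auto simp: algebra_simps)
    also have "\<dots> = (norm g2 + C)\<^sup>2 * \<rho> ^ 4"
      by (simp add: power_mult_distrib)
    also have "\<dots> \<le> (norm g2 + C)\<^sup>2 * \<rho> ^ 3"
      using \<rho> \<rho>le by (intro mult_left_mono power_decreasing) auto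
    finally have y: "(norm y)\<^sup>2 \<le> (norm g2 + C)\<^sup>2 * \<rho> ^ 3" .
    have "(\<gamma> t0 - q0) \<bullet> r \<le> norm (\<gamma> t0 - q0) * norm r"
      by (rule norm_cauchy_schwarz)
    also have "\<dots> \<le> \<beta> * (C * \<rho> ^ 3)"
      using close r \<beta> by (intro mult_mono) auto
    finally have dr: "(\<gamma> t0 - q0) \<bullet> r \<le> \<beta> * C * \<rho> ^ 3" by simp
    \<comment> \<open>Moving \<open>q0\<close> along \<open>g1\<close> cancels the first-order
      motion of the disc exactly, leaving only \<open>y\<close>.\<close>
    have split: "\<gamma> (t0 + t) - (q0 + csc t g1) = (\<gamma> t0 - q0) + y"
      by (simp add: y_def r_def)
    have "(norm (p + y))\<^sup>2 = (norm p)\<^sup>2 + 2 * (p \<bullet> y) + (norm y)\<^sup>2" for p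
      by (simp add: power2_norm_eq_inner inner_add inner_commute)
    then have "(norm (\<gamma> (t0 + t) - (q0 + csc t g1)))\<^sup>2
        = (norm (\<gamma> t0 - q0))\<^sup>2 + 2 * ((\<gamma> t0 - q0) \<bullet> y) + (norm y)\<^sup>2"
      unfolding split .
    also have "\<dots> \<le> (norm (\<gamma> t0 - q0))\<^sup>2 + 2 * Re (c * t\<^sup>2) + C' * \<rho> ^ 3"
      using dr y c[of "t\<^sup>2"] by (simp add: y_def inner_add_right C'_def algebra_simps)
    finally have X: "A * (norm (\<gamma> (t0 + t) - (q0 + csc t g1)))\<^sup>2
       \<le> A * ((norm (\<gamma> t0 - q0))\<^sup>2 + 2 * Re (c * t\<^sup>2) + C' * \<rho> ^ 3)"
      using A by (intro mult_left_mono) auto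
    have "t0 + t \<in> cball 0 1"
      using norm_triangle_ineq[of t0 t] nt \<rho>1(2) by simp
    then have "\<Phi> (t0 + t, q0 + csc t g1) \<le> \<Phi> (t0, q0)"
      by (rule max) (use inK nt in auto)
    moreover have "(norm (t0 + t))\<^sup>2 = (norm t0)\<^sup>2 + 2 * Re (cnj t0 * t) + \<rho>\<^sup>2"
      unfolding nt[symmetric] cmod_power2 by (simp add: power2_eq_square algebra_simps)
    ultimately have "v (q0 + csc t g1) \<le> v q0 - 2 * \<delta> * Re (cnj t0 * t) - \<delta> * \<rho>\<^sup>2
        + 2 * A * Re (c * t\<^sup>2) + A * C' * \<rho> ^ 3"
      using X by (simp add: \<Phi>_def algebra_simps)
    moreover have "A * C' * \<rho> ^ 3 \<le> \<delta> * \<rho>\<^sup>2 / 2"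
    proof -
      have "A * C' * \<rho> \<le> \<delta> / 2" using \<rho>2(2) \<rho> nonneg by (simp add: algebra_simps)
      then have "(A * C' * \<rho>) * \<rho>\<^sup>2 \<le> (\<delta> / 2) * \<rho>\<^sup>2" by (intro mult_right_mono) auto
      then show ?thesis by (simp add: power3_eq_cube power2_eq_square mult.assoc)
    qed
    ultimately have "v (q0 + csc t g1) \<le> Re (H t)"
      by (simp add: H_def algebra_simps)
    moreover have "u (q0 + csc t g1) \<le> ereal (v (q0 + csc t g1))"
      by (intro uv subsetD[OF K(2)] inK) (simp add: nt)
    ultimately show ?thesis
      unfolding cline_pt_csc by (metis ereal_less_eq(3) order_trans)
  qed
  have "subharmonic_on {t. cline_pt q0 g1 t \<in> \<Omega>} (\<lambda>t. u (cline_pt q0 g1 t))"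
    using psh g unfolding psh_on_def by blast
  moreover have "cball 0 \<rho> \<subseteq> {t. cline_pt q0 g1 t \<in> \<Omega>}"
    using inK K by (auto simp: cline_pt_csc)
  moreover have "continuous_on (cball 0 \<rho>) (\<lambda>t. Re (H t))"
    unfolding H_def by (intro continuous_intros)
  moreover have "H holomorphic_on ball 0 \<rho>"
    unfolding H_def by (intro holomorphic_intros)
  then have "harmonic_on_ball (\<lambda>t. Re (H t)) 0 \<rho>"
    unfolding harmonic_on_ball_def by blast
  ultimately have "u (cline_pt q0 g1 0) \<le> ereal (Re (H 0))"
    using bound \<rho> unfolding subharmonic_on_def by (smt (verit) centre_in_cball)
  then have "v q0 \<le> v q0 - \<delta> * \<rho>\<^sup>2 / 2"
    by (simp add: cline_pt_def uq0 H_def)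
  moreover have "\<delta> * \<rho>\<^sup>2 > 0" using \<delta> \<rho> by simp
  ultimately show False by linarith
qed

text \<open>The disc moves with constant velocity \<open>b\<close> in the second factor, so its
  tangent is nonzero even at critical points of \<open>\<phi>\<close>.\<close>

lemma psh_graph_max_principle:
  fixes u :: "(complex^'n) \<times> (complex^'m) \<Rightarrow> ereal"
  assumes "open \<Omega>" "continuous_on \<Omega> u" "psh_on \<Omega> u"
    and \<phi>: "\<phi> holomorphic_on S" "open S" "cball 0 1 \<subseteq> S" and "b \<noteq> 0"
    and sub: "\<And>t. t \<in> cball 0 1 \<Longrightarrow> (a + \<phi> t *s \<zeta>, w + t *s b) \<in> \<Omega>"
    and bd: "\<And>t. t \<in> sphere 0 1 \<Longrightarrow> u (a + \<phi> t *s \<zeta>, w + t *s b) \<le> ereal k"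
    and t: "t \<in> cball 0 1"
  shows "u (a + \<phi> t *s \<zeta>, w + t *s b) \<le> ereal k"
proof (rule psh_disc_max_principle[OF assms(1-3) _ _ _ bd t])
  have "continuous_on (cball 0 1) \<phi>"
    using \<phi> holomorphic_on_imp_continuous_on continuous_on_subset by blast
  then show "continuous_on (cball 0 1) (\<lambda>t. (a + \<phi> t *s \<zeta>, w + t *s b))"
    unfolding vector_scalar_mult_def
    by (intro continuous_intros)
  show "(\<lambda>t. (a + \<phi> t *s \<zeta>, w + t *s b)) ` cball 0 1 \<subseteq> \<Omega>"
    using sub by auto
  fix s :: complex assume "s \<in> ball 0 1"
  then have "s \<in> S" using \<phi> by auto
  then obtain c1 c2 C e where e: "e > 0" "C \<ge> 0"
    and ex: "\<And>t. norm t < e \<Longrightarrow> norm (\<phi> (s + t) - (\<phi> s + c1 * t + c2 * t\<^sup>2)) \<le> C * norm t ^ 3"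
    using holomorphic_second_order_expansion[OF \<phi>(1,2)] by metis
  show "\<exists>g1 g2 C e. e > 0 \<and> C \<ge> 0 \<and> g1 \<noteq> 0 \<and> (\<forall>t. norm t < e \<longrightarrow>
      norm ((a + \<phi> (s + t) *s \<zeta>, w + (s + t) *s b) - ((a + \<phi> s *s \<zeta>, w + s *s b) + csc t g1 + csc (t\<^sup>2) g2))
        \<le> C * norm t ^ 3)"
  proof (intro exI conjI allI impI)
    show "(c1 *s \<zeta>, b) \<noteq> 0" using \<open>b \<noteq> 0\<close> by (simp add: zero_prod_def)
    show "C * norm \<zeta> \<ge> 0" using e by simp
    fix t :: complex assume "norm t < e"
    have "(a + \<phi> (s + t) *s \<zeta>, w + (s + t) *s b) -
        ((a + \<phi> s *s \<zeta>, w + s *s b) + csc t (c1 *s \<zeta>, b) + csc (t\<^sup>2) (c2 *s \<zeta>, 0))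
      = ((\<phi> (s + t) - (\<phi> s + c1 * t + c2 * t\<^sup>2)) *s \<zeta>, 0)"
      by (simp add: csc_def vec_eq_iff algebra_simps)
    then have "norm ((a + \<phi> (s + t) *s \<zeta>, w + (s + t) *s b) -
        ((a + \<phi> s *s \<zeta>, w + s *s b) + csc t (c1 *s \<zeta>, b) + csc (t\<^sup>2) (c2 *s \<zeta>, 0)))
      = norm (\<phi> (s + t) - (\<phi> s + c1 * t + c2 * t\<^sup>2)) * norm \<zeta>"
      by (simp only: norm_Pair norm_vector_smult) simp
    also have "\<dots> \<le> C * norm t ^ 3 * norm \<zeta>"
      by (intro mult_right_mono ex \<open>norm t < e\<close>) simp
    finally show "norm ((a + \<phi> (s + t) *s \<zeta>, w + (s + t) *s b) -
        ((a + \<phi> s *s \<zeta>, w + s *s b) + csc t (c1 *s \<zeta>, b) + csc (t\<^sup>2) (c2 *s \<zeta>, 0))) \<le> C * norm \<zeta> * norm t ^ 3"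
      by (simp only: mult_ac)
  qed (rule e)
qed

section \<open>Holomorphic majorants of small subsets of the circle\<close>

text \<open>The kernel has its pole at \<open>1 + s\<close>, just outside the unit disc, and
  inversion preserves the right half plane. The pole is close enough to make the kernel large on an
  arc of size \<open>s\<close> about 1, while far from 1 it is only of order
  \<open>s\<close>.\<close>

lemma
  fixes y :: complex and s :: real
  assumes s: "s > 0" and y: "norm y \<le> 1"
  shows Re_arc_kernel_nonneg: "Re (4 * s / (1 + s - y)) \<ge> 0"
    and Re_arc_kernel_ge_1: "norm (1 - y) \<le> s \<Longrightarrow> Re (4 * s / (1 + s - y)) \<ge> 1"
    and Re_arc_kernel_le: "norm y \<le> 1/2 \<Longrightarrow> Re (4 * s / (1 + s - y)) \<le> 8 * s"
proof -
  have re: "Re (1 + s - y) \<ge> s"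
    using y complex_Re_le_cmod[of y] by simp
  have nz: "1 + s - y \<noteq> 0" using re s by (metis not_le zero_complex.sel(1))
  have eq: "Re (4 * s / (1 + s - y)) = 4 * s * Re (1 + s - y) / (norm (1 + s - y))\<^sup>2"
    using complex_div_cnj[of "4 * s" "1 + s - y"] by (simp add: Re_divide cmod_power2 power2_eq_square)
  show "Re (4 * s / (1 + s - y)) \<ge> 0"
    unfolding eq using re s by (intro divide_nonneg_nonneg mult_nonneg_nonneg) auto
  show "Re (4 * s / (1 + s - y)) \<ge> 1" if "norm (1 - y) \<le> s"
  proof -
    have "norm (1 + s - y) \<le> 2 * s"
      using norm_triangle_ineq[of "1 - y" "of_real s"] that s by (simp add: algebra_simps)
    then have "(norm (1 + s - y))\<^sup>2 \<le> (2 * s)\<^sup>2"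
      by (intro power_mono) auto
    also have "\<dots> = 4 * s * s" by (simp add: power2_eq_square)
    also have "\<dots> \<le> 4 * s * Re (1 + s - y)"
      using re s by (intro mult_left_mono) auto
    finally show ?thesis unfolding eq using nz by (simp add: le_divide_eq)
  qed
  show "Re (4 * s / (1 + s - y)) \<le> 8 * s" if "norm y \<le> 1/2"
  proof -
    have "1/2 \<le> norm (1 + s - y)"
      using complex_Re_le_cmod[of "1 + s - y"] complex_Re_le_cmod[of y] that s by simp
    then have "norm (4 * s / (1 + s - y)) \<le> 4 * s / (1/2)"
      unfolding norm_divide using s by (intro frac_le) (auto simp: norm_mult)
    then show ?thesis using complex_Re_le_cmod[of "4 * s / (1 + s - y)"] by simp
  qed
qed

lemma dist_cis_le: "dist (cis x) (cis y) \<le> \<bar>x - y\<bar>"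
proof -
  have "cis x - cis y = cis y * (cis (x - y) - 1)"
    by (simp add: right_diff_distrib cis_mult)
  also have "cis (x - y) = exp (\<i> * of_real (x - y))"
    by (simp only: cis_conv_exp)
  finally have "dist (cis x) (cis y) = 2 * \<bar>sin ((x - y) / 2)\<bar>"
    by (simp add: dist_norm norm_mult flip: dist_exp_i_1)
  also have "\<dots> \<le> \<bar>x - y\<bar>"
    using abs_sin_x_le_abs_x[of "(x - y) / 2"] by simp
  finally show ?thesis .
qed

text \<open>For a mesh finer than the distance from \<open>K\<close> to \<open>F\<close>, every grid
  cell meeting \<open>K\<close> misses \<open>F\<close>. The measure of the complement of
  \<open>F\<close> therefore bounds the number of such cells, and \<open>J\<close> collects their
  left endpoints.\<close>

lemma compact_grid_cover:
  fixes F K :: "real set"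
  assumes F: "closed F" and K: "compact K" "K \<subseteq> {0..1}" "K \<inter> F = {}"
    and small: "measure lborel ({0..1} - F) < \<eta>"
  obtains N :: nat and J where "N > 0" "finite J" "card J / N \<le> \<eta>"
    "\<And>x. x \<in> K \<Longrightarrow> \<exists>j\<in>J. \<bar>x - real j / N\<bar> \<le> 1 / N"
proof -
  obtain d where d: "d > 0" "\<And>x y. x \<in> K \<Longrightarrow> y \<in> F \<Longrightarrow> d \<le> dist x y"
    using separate_compact_closed[OF K(1) F K(3)] by blast
  obtain N :: nat where N: "N > 0" "1 / N < d"
    using d(1) by (metis nat_approx_posE of_nat_0_less_iff zero_less_Suc)
  \<comment> \<open>Open cells are genuinely disjoint, so their lengths add up.\<close>
  define I where "I j = {real j / N <..< (real j + 1) / N}" for j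
  define J where "J = {j. j < N \<and> (\<exists>x\<in>K. real j / N \<le> x \<and> x \<le> (real j + 1) / N)}"
  have J: "finite J" by (simp add: J_def)
  have disj: "disjoint_family_on I J"
  proof -
    have "I i \<inter> I j = {}" if "i < j" for i j
    proof -
      have "(real i + 1) / N \<le> real j / N" using that N by (intro divide_right_mono) auto
      then show ?thesis by (auto simp: I_def)
    qed
    then show ?thesis unfolding disjoint_family_on_def by (metis Int_commute linorder_neqE_nat)
  qed
  have "card J / N = (\<Sum>j\<in>J. measure lborel (I j))"
    by (simp add: I_def divide_right_mono flip: diff_divide_distrib)
  also have "\<dots> = measure lborel (\<Union>j\<in>J. I j)"
  proof (rule measure_finite_Union[symmetric])
    have "real j / N \<le> (real j + 1) / N" for j
      by (intro divide_right_mono) auto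
    then show "emeasure lborel (I j) \<noteq> \<infinity>" for j
      by (simp add: I_def)
  qed (simp_all add: J disj, auto simp: I_def)
  also have "\<dots> \<le> measure lborel ({0..1} - F)"
  proof (rule measure_mono_fmeasurable)
    show "(\<Union>j\<in>J. I j) \<subseteq> {0..1} - F"
    proof clarify
      fix j x assume j: "j \<in> J" and x: "x \<in> I j"
      have "(real j + 1) / N \<le> 1" using j N by (auto simp: J_def)
      moreover have "real j / N < x" "x < (real j + 1) / N" using x by (simp_all add: I_def)
      moreover have "0 \<le> real j / N" by (intro divide_nonneg_nonneg) auto
      ultimately have "x \<in> {0..1}" unfolding atLeastAtMost_iff by linarith
      moreover have "x \<notin> F"
      proof
        assume "x \<in> F"
        obtain y where y: "y \<in> K" "real j / N \<le> y" "y \<le> (real j + 1) / N"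
          using j by (auto simp: J_def)
        have "\<bar>y - x\<bar> \<le> 1 / N" using x y by (auto simp: I_def add_divide_distrib)
        then show False using d(2)[OF y(1) \<open>x \<in> F\<close>] N by (simp add: dist_real_def)
      qed
      ultimately show "x \<in> {0..1} - F" by simp
    qed
    show "{0..1} - F \<in> fmeasurable lborel"
      using F by (intro fmeasurable_Diff fmeasurable_compact) (auto intro: fmeasurable_compact)
  qed (simp add: I_def)
  finally have "card J / N \<le> \<eta>" using small by simp
  moreover have "\<exists>j\<in>J. \<bar>x - real j / N\<bar> \<le> 1 / N" if "x \<in> K" for x
  proof -
    have x: "0 \<le> x" "x \<le> 1" using that K by auto
    have "\<exists>j<N. real j / N \<le> x \<and> x \<le> (real j + 1) / N"
    proof (cases "x = 1")
      \<comment> \<open>The right end of the interval belongs to the last closed cell; rounding down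
        would give the index \<open>N\<close>, one too many.\<close>
      case True
      then show ?thesis using N by (intro exI[of _ "N - 1"]) (auto simp: of_nat_diff)
    next
      case False
      define j where "j = nat \<lfloor>N * x\<rfloor>"
      have j: "real j \<le> N * x" "N * x < real j + 1"
        using x N by (auto simp: j_def)
      have "N * x < N" using False x N by simp
      then have "j < N" using j by linarith
      then show ?thesis using j N by (intro exI[of _ j]) (auto simp: field_simps)
    qed
    then obtain j where j: "j < N" "real j / N \<le> x" "x \<le> (real j + 1) / N" by blast
    then have "j \<in> J" using that by (auto simp: J_def)
    moreover have "\<bar>x - real j / N\<bar> \<le> 1 / N" using j by (auto simp: add_divide_distrib)
    ultimately show ?thesis by blast
  qed
  ultimately show ?thesis using that N J by blast
qed

text \<open>One rotated arc kernel is summed for each grid point. Near \<open>K\<close> a single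
  kernel already reaches 1 and the others only add; on the half disc each contributes at most
  \<open>8 * s\<close>, so the total is controlled by the number of cells.\<close>

lemma holomorphic_majorant_of_small_set:
  fixes F K :: "real set"
  assumes "closed F" "compact K" "K \<subseteq> {0..1}" "K \<inter> F = {}"
    and "measure lborel ({0..1} - F) < \<eta>"
  obtains f S where "open S" "cball 0 1 \<subseteq> S" "f holomorphic_on S"
    "\<And>t. t \<in> cball 0 1 \<Longrightarrow> Re (f t) \<ge> 0"
    "\<And>x. x \<in> K \<Longrightarrow> Re (f (cis (2 * pi * x))) \<ge> 1"
    "\<And>t. t \<in> cball 0 (1/2) \<Longrightarrow> Re (f t) \<le> 64 * \<eta>"
proof -
  obtain N :: nat and J where N: "N > 0" and J: "finite J" "card J / N \<le> \<eta>"
    and cover: "\<And>x. x \<in> K \<Longrightarrow> \<exists>j\<in>J. \<bar>x - real j / N\<bar> \<le> 1 / N"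
    using compact_grid_cover[OF assms] by blast
  \<comment> \<open>A grid step of \<open>1 / N\<close> is an arc of length
    \<open>2 * pi / N\<close>, which is less than \<open>8 / N\<close>.\<close>
  define s where "s = 8 / real N"
  have s: "s > 0" using N by (simp add: s_def)
  \<comment> \<open>The rotation carries the grid point with index \<open>j\<close> to 1, where the
    kernel is centred.\<close>
  define y where "y j t = cis (- (2 * pi * (real j / N))) * t" for j t
  have norm_y: "norm (y j t) = norm t" for j t by (simp add: y_def norm_mult)
  define f where "f t = (\<Sum>j\<in>J. 4 * s / (1 + s - y j t))" for t
  show ?thesis
  proof (rule that[of "ball 0 (1 + s)" f])
    show "cball 0 1 \<subseteq> ball (0::complex) (1 + s)" using s by auto
    have "1 + s - y j t \<noteq> 0" if "t \<in> ball 0 (1 + s)" for j t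
    proof
      assume "1 + s - y j t = 0"
      then have "y j t = of_real (1 + s)" by (simp add: algebra_simps)
      then have "norm (y j t) = 1 + s" using s by (simp del: of_real_add)
      then show False using that norm_y by simp
    qed
    then show "f holomorphic_on ball 0 (1 + s)"
      unfolding f_def y_def by (auto intro!: holomorphic_intros)
    show "Re (f t) \<ge> 0" if "t \<in> cball 0 1" for t
      unfolding f_def Re_sum using that norm_y s by (intro sum_nonneg Re_arc_kernel_nonneg) auto
    show "Re (f t) \<le> 64 * \<eta>" if "t \<in> cball 0 (1/2)" for t
    proof -
      have "Re (f t) \<le> (\<Sum>j\<in>J. 8 * s)"
        unfolding f_def Re_sum using that norm_y s by (intro sum_mono Re_arc_kernel_le) auto
      also have "\<dots> = 64 * (card J / N)" by (simp add: s_def)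
      finally show ?thesis using J by linarith
    qed
    show "Re (f (cis (2 * pi * x))) \<ge> 1" if xK: "x \<in> K" for x
    proof -
      define t where "t = cis (2 * pi * x)"
      obtain j where j: "j \<in> J" "\<bar>x - real j / N\<bar> \<le> 1 / N" using cover[OF xK] by blast
      have "norm (1 - y j t) = dist (cis 0) (cis (2 * pi * (x - real j / N)))"
        by (simp add: y_def t_def dist_norm cis_mult algebra_simps)
      also have "\<dots> \<le> 2 * pi * \<bar>x - real j / N\<bar>"
        using dist_cis_le[of 0 "2 * pi * (x - real j / N)"] by (simp add: abs_mult)
      also have "\<dots> \<le> 2 * 4 * (1 / N)"
        using j pi_less_4 by (intro mult_mono) auto
      finally have "norm (1 - y j t) \<le> s" by (simp add: s_def)
      then have "1 \<le> Re (4 * s / (1 + s - y j t))"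
        using s norm_y by (intro Re_arc_kernel_ge_1) (auto simp: t_def)
      also have "\<dots> \<le> Re (f t)"
        unfolding f_def Re_sum using J j norm_y s
        by (intro member_le_sum Re_arc_kernel_nonneg) (auto simp: t_def)
      finally show ?thesis by (simp add: t_def)
    qed
  qed simp
qed

section \<open>Hartogs' argument in one parameter\<close>

lemma le_ereal_trans: "v \<le> ereal c \<Longrightarrow> c \<le> d \<Longrightarrow> v \<le> ereal d"
  by (meson ereal_less_eq(3) order_trans)

text \<open>The maximum principle is a hypothesis so that the lemma applies to functions of one coordinate
  of \<open>w\<close> with the others as parameters.\<close>

lemma hartogs_family_extension:
  fixes V :: "(complex^'n \<Rightarrow> complex \<Rightarrow> ereal) set"
  assumes r: "0 < r" "r \<le> R" and R': "0 < R'" "R' < R"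
    and cont: "\<And>v. v \<in> V \<Longrightarrow> continuous_on (cball a R \<times> cball 0 1) (\<lambda>(z, t). v z t)"
    and max_principle: "\<And>v \<phi> \<zeta> S k t. \<lbrakk>v \<in> V; open S; cball 0 1 \<subseteq> S; \<phi> holomorphic_on S;
        \<And>t. t \<in> cball 0 1 \<Longrightarrow> norm (\<phi> t *s \<zeta>) \<le> R;
        \<And>t. t \<in> sphere 0 1 \<Longrightarrow> v (a + \<phi> t *s \<zeta>) t \<le> ereal k; t \<in> cball 0 1\<rbrakk>
        \<Longrightarrow> v (a + \<phi> t *s \<zeta>) t \<le> ereal k"
    and small: "\<And>v z t. \<lbrakk>v \<in> V; z \<in> cball a r; t \<in> sphere 0 1\<rbrakk> \<Longrightarrow> v z t \<le> ereal k0"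
    and slices: "\<And>t. t \<in> sphere 0 1 \<Longrightarrow> \<exists>k::real. \<forall>v\<in>V. \<forall>z\<in>cball a R. v z t \<le> ereal k"
  shows "\<exists>k::real. \<forall>v\<in>V. \<forall>z\<in>cball a R'. \<forall>t\<in>cball 0 (1/2). v z t \<le> ereal k"
proof -
  have "R > 0" using r by linarith
  define e where "e x = cis (2 * pi * x)" for x
  have e: "e x \<in> sphere 0 1" for x by (simp add: e_def)
  have cont_e: "continuous_on A e" for A
    unfolding e_def by (intro continuous_intros)
  define F where "F k = {x. \<forall>v\<in>V. \<forall>z\<in>cball a R. v z (e x) \<le> ereal (real k)}" for k :: nat
  have F_closed: "closed (F k)" for k
  proof -
    have "closed {x. v z (e x) \<le> ereal (real k)}" if "v \<in> V" "z \<in> cball a R" for v z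
    proof (rule closed_Collect_le)
      have "continuous_on UNIV (\<lambda>x. (\<lambda>(z, t). v z t) (z, e x))"
        by (rule continuous_on_compose2[OF cont[OF that(1)]])
          (use that e in \<open>auto intro!: continuous_intros cont_e\<close>)
      then show "continuous_on UNIV (\<lambda>x. v z (e x))" by simp
    qed simp
    moreover have "F k = (\<Inter>v\<in>V. \<Inter>z\<in>cball a R. {x. v z (e x) \<le> ereal (real k)})"
      by (auto simp: F_def)
    ultimately show ?thesis by (simp only:) (intro closed_INT ballI)
  qed
  \<comment> \<open>The sets \<open>F k\<close> increase with \<open>k\<close> and, by
    \<open>slices\<close>, exhaust all angles, so the exceptional measure tends to 0 uniformly over
    the family.\<close>
  have "(\<lambda>k. measure lborel ({0..1} - F k)) \<longlonglongrightarrow> measure lborel (\<Inter>k. {0..1} - F k)"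
  proof (rule Lim_measure_decseq)
    show "range (\<lambda>k. {0..1} - F k) \<subseteq> sets lborel"
      using F_closed by auto
    show "decseq (\<lambda>k. {0..1} - F k)"
    proof (rule decseq_SucI)
      have "v z (e x) \<le> ereal (real (Suc k))" if "x \<in> F k" "v \<in> V" "z \<in> cball a R" for k x v z
        by (rule le_ereal_trans[of _ "real k"]) (use that in \<open>auto simp: F_def\<close>)
      then have "F k \<subseteq> F (Suc k)" for k
        unfolding F_def[of "Suc k"] by blast
      then show "{0..1} - F (Suc k) \<subseteq> {0..1} - F k" for k by blast
    qed
    show "emeasure lborel ({0..1} - F k) \<noteq> \<infinity>" for k
      using emeasure_mono[of "{0..1} - F k" "{0..1}" lborel] by (auto simp: top_unique)
  qed
  moreover have "(\<Inter>k. {0..1} - F k) = {}"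
  proof -
    have "x \<in> (\<Union>k. F k)" for x
    proof -
      obtain k :: real where k: "\<forall>v\<in>V. \<forall>z\<in>cball a R. v z (e x) \<le> ereal k"
        using slices[OF e] by blast
      obtain n :: nat where "k \<le> real n" using real_arch_simple by blast
      then have "x \<in> F n" using k by (auto simp: F_def intro: le_ereal_trans)
      then show ?thesis by blast
    qed
    then show ?thesis by blast
  qed
  ultimately have lim: "(\<lambda>k. measure lborel ({0..1} - F k)) \<longlonglongrightarrow> 0"
    by (simp only: measure_empty)
  \<comment> \<open>With this \<open>L\<close>, the factor \<open>exp (- L)\<close> shrinks radius
    \<open>R\<close> to \<open>r\<close>, as required where \<open>Re f\<close> is at least
    1.\<close>
  define L where "L = ln (R / r)"
  have L: "L \<ge> 0" "exp (- L) = r / R" using r \<open>R > 0\<close> by (auto simp: L_def exp_minus)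
  \<comment> \<open>Chosen so that undoing the shrinking at a point of the half disc costs at most
    the factor \<open>R / R'\<close>. The added one covers \<open>r = R\<close>, where
    \<open>L\<close> vanishes.\<close>
  define \<eta> where "\<eta> = ln (R / R') / (64 * (L + 1))"
  have "ln (R / R') > 0" using R' by simp
  then have \<eta>: "\<eta> > 0" and "L * (64 * \<eta>) \<le> ln (R / R')"
    using L by (auto simp: \<eta>_def field_simps)
  then have exp_\<eta>: "exp (L * (64 * \<eta>)) \<le> R / R'"
    using R' by (subst ln_ge_iff[symmetric]) auto
  have "eventually (\<lambda>k. measure lborel ({0..1} - F k) < \<eta>) sequentially"
    using lim \<eta> by (rule order_tendstoD)
  moreover have "eventually (\<lambda>k. real k \<ge> k0) sequentially"
    using filterlim_real_sequentially by (simp add: filterlim_at_top)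
  ultimately have "eventually (\<lambda>k. measure lborel ({0..1} - F k) < \<eta> \<and> real k \<ge> k0) sequentially"
    by (rule eventually_conj)
  then obtain k where k: "measure lborel ({0..1} - F k) < \<eta>" "real k \<ge> k0"
    using eventually_happens by fastforce
  have "v z t0 \<le> ereal (real k + 1)"
    if v: "v \<in> V" and z: "z \<in> cball a R'" and t0: "t0 \<in> cball 0 (1/2)" for v z t0
  proof -
    \<comment> \<open>The threshold \<open>real k + 1\<close> instead of \<open>real k\<close>
      allows a non-strict inequality, which makes \<open>K\<close> compact, and still keeps
      \<open>K\<close> disjoint from \<open>F k\<close>. This set depends on \<open>v\<close>; the
      measure bound does not.\<close>
    define K where "K = {x \<in> {0..1}. \<exists>z\<in>cball a R. v z (e x) \<ge> ereal (real k + 1)}"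
    have K_eq: "K = snd ` {p \<in> cball a R \<times> {0..1}. ereal (real k + 1) \<le> v (fst p) (e (snd p))}"
      by (force simp: K_def)
    have "compact {p \<in> cball a R \<times> {0..1}. ereal (real k + 1) \<le> v (fst p) (e (snd p))}"
    proof -
      have "continuous_on (cball a R \<times> {0..1}) (\<lambda>p. (\<lambda>(z, t). v z t) (fst p, e (snd p)))"
        by (rule continuous_on_compose2[OF cont[OF v]])
          (use e in \<open>auto intro!: continuous_intros continuous_on_compose2[OF cont_e[of UNIV]]\<close>)
      then have "closed ((cball a R \<times> {0..1}) \<inter> (\<lambda>p. v (fst p) (e (snd p))) -` {ereal (real k + 1)..})"
        by (intro continuous_closed_preimage closed_Times) auto
      then have "compact ((cball a R \<times> {0..1}) \<inter>
          ((cball a R \<times> {0..1}) \<inter> (\<lambda>p. v (fst p) (e (snd p))) -` {ereal (real k + 1)..}))"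
        by (intro compact_Int_closed compact_Times) auto
      also have "(cball a R \<times> {0..1}) \<inter>
          ((cball a R \<times> {0..1}) \<inter> (\<lambda>p. v (fst p) (e (snd p))) -` {ereal (real k + 1)..})
          = {p \<in> cball a R \<times> {0..1}. ereal (real k + 1) \<le> v (fst p) (e (snd p))}"
        by auto
      finally show ?thesis .
    qed
    then have compact_K: "compact K"
      unfolding K_eq by (intro compact_continuous_image continuous_intros)
    have K01: "K \<subseteq> {0..1}" by (auto simp: K_def)
    have KF: "K \<inter> F k = {}"
    proof -
      have "\<not> ereal (real k + 1) \<le> v z (e x)" if "x \<in> F k" "z \<in> cball a R" for x z
      proof
        assume "ereal (real k + 1) \<le> v z (e x)"
        also have "v z (e x) \<le> ereal (real k)" using that v by (auto simp: F_def)
        finally show False by simp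
      qed
      then show ?thesis by (force simp: K_def)
    qed
    obtain f S where S: "open S" "cball 0 1 \<subseteq> S" and f: "f holomorphic_on S"
      and f0: "\<And>t. t \<in> cball 0 1 \<Longrightarrow> Re (f t) \<ge> 0"
      and f1: "\<And>x. x \<in> K \<Longrightarrow> Re (f (e x)) \<ge> 1"
      and f2: "\<And>t. t \<in> cball 0 (1/2) \<Longrightarrow> Re (f t) \<le> 64 * \<eta>"
      by (rule holomorphic_majorant_of_small_set[OF F_closed compact_K K01 KF k(1), folded e_def])
        (rule that, assumption+)
    \<comment> \<open>The factor cancels \<open>\<phi> t0\<close>, so that the disc passes through
      \<open>z\<close> at the parameter \<open>t0\<close>.\<close>
    define \<zeta> where "\<zeta> = exp (L * f t0) *s (z - a)"
    have "norm \<zeta> = exp (L * Re (f t0)) * norm (z - a)"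
      unfolding \<zeta>_def norm_vector_smult by (simp add: norm_exp_eq_Re)
    also have "\<dots> \<le> (R / R') * R'"
    proof (rule mult_mono)
      have "exp (L * Re (f t0)) \<le> exp (L * (64 * \<eta>))"
        using f2[OF t0] L by (simp add: mult_left_mono)
      then show "exp (L * Re (f t0)) \<le> R / R'" using exp_\<eta> by linarith
    qed (use z R' \<open>R > 0\<close> in \<open>auto simp: dist_norm norm_minus_commute\<close>)
    finally have norm_\<zeta>: "norm \<zeta> \<le> R" using R' by simp
    define \<phi> where "\<phi> t = exp (- (L * f t))" for t
    have norm_\<phi>: "norm (\<phi> t *s \<zeta>) = exp (- (L * Re (f t))) * norm \<zeta>" for t
      by (simp add: \<phi>_def norm_vector_smult norm_exp_eq_Re)
    have norm_\<phi>_le: "norm (\<phi> t *s \<zeta>) \<le> R" if "t \<in> cball 0 1" for t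
    proof -
      have "exp (- (L * Re (f t))) * norm \<zeta> \<le> 1 * R"
        using f0[OF that] L norm_\<zeta> by (intro mult_mono) auto
      then show ?thesis by (simp add: norm_\<phi>)
    qed
    have "v (a + \<phi> t0 *s \<zeta>) t0 \<le> ereal (real k + 1)"
    proof (rule max_principle[OF v S _ norm_\<phi>_le])
      show "\<phi> holomorphic_on S" unfolding \<phi>_def using f by (intro holomorphic_intros)
      show "t0 \<in> cball 0 1" using t0 by simp
      fix t :: complex assume t: "t \<in> sphere 0 1"
      obtain x where x: "x \<in> {0..1}" "t = e x"
      proof -
        have "t = cis (Arg2pi t)"
          using t complex_norm_eq_1_exp[of t] by (simp add: cis_conv_exp)
        then show ?thesis
          using Arg2pi[of t] that[of "Arg2pi t / (2 * pi)"] by (simp add: e_def)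
      qed
      show "v (a + \<phi> t *s \<zeta>) t \<le> ereal (real k + 1)"
      \<comment> \<open>Over \<open>K\<close> the disc has shrunk into the ball of radius
        \<open>r\<close>, where \<open>small\<close> applies; elsewhere \<open>v\<close> is below
        the threshold on the whole ball of radius \<open>R\<close>.\<close>
      proof (cases "x \<in> K")
        case True
        have "L * 1 \<le> L * Re (f t)"
          using f1[OF True] x L(1) by (intro mult_left_mono) auto
        then have "exp (- (L * Re (f t))) \<le> r / R"
          unfolding L(2)[symmetric] by simp
        then have "exp (- (L * Re (f t))) * norm \<zeta> \<le> (r / R) * R"
          using norm_\<zeta> L r \<open>R > 0\<close> by (intro mult_mono) auto
        then have "a + \<phi> t *s \<zeta> \<in> cball a r"
          using \<open>R > 0\<close> norm_\<phi>[of t] by (simp add: dist_norm)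
        then have "v (a + \<phi> t *s \<zeta>) t \<le> ereal k0" using small v t by blast
        also have "\<dots> \<le> ereal (real k + 1)" using k by simp
        finally show ?thesis .
      next
        case False
        have "a + \<phi> t *s \<zeta> \<in> cball a R"
          using norm_\<phi>_le[of t] t by (simp add: dist_norm)
        then show ?thesis using False x by (force simp: K_def)
      qed
    qed
    moreover have "\<phi> t0 *s \<zeta> = z - a"
      by (simp add: \<phi>_def \<zeta>_def vector_smult_assoc flip: exp_add)
    ultimately show ?thesis by simp
  qed
  then show ?thesis by blast
qed

section \<open>Polydiscs, one coordinate at a time\<close>

definition polydisc :: "complex^'m \<Rightarrow> real \<Rightarrow> (complex^'m) set" where
  "polydisc c \<rho> = {w. \<forall>i. dist (c $ i) (w $ i) \<le> \<rho>}"

lemma dist_vec_le_of_mem_polydisc: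
  fixes c :: "complex^'m" and \<rho> :: real
  assumes "w \<in> polydisc c \<rho>"
  shows "dist c w \<le> real CARD('m) * \<rho>"
proof -
  have "dist c w \<le> (\<Sum>i\<in>UNIV. dist (c $ i) (w $ i))"
    unfolding dist_vec_def by (rule L2_set_le_sum) simp
  also have "\<dots> \<le> (\<Sum>i\<in>(UNIV :: 'm set). \<rho>)"
    using assms by (intro sum_mono) (auto simp: polydisc_def)
  finally show ?thesis by simp
qed

lemma compact_polydisc: "compact (polydisc (c :: complex^'m) \<rho>)"
proof -
  have "polydisc c \<rho> \<subseteq> cball c (real CARD('m) * \<rho>)"
    using dist_vec_le_of_mem_polydisc by auto
  then have "bounded (polydisc c \<rho>)" using bounded_cball bounded_subset by blast
  moreover have "closed (polydisc c \<rho>)"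
    unfolding polydisc_def by (intro closed_Collect_all closed_Collect_le continuous_intros)
  ultimately show ?thesis by (simp add: compact_eq_bounded_closed)
qed

lemma polydisc_subset_open:
  fixes c :: "complex^'m"
  assumes "open G" "c \<in> G"
  obtains \<rho> where "\<rho> > 0" "polydisc c \<rho> \<subseteq> G"
proof -
  obtain e where e: "e > 0" "cball c e \<subseteq> G" using assms open_contains_cball by blast
  have "polydisc c (e / real CARD('m)) \<subseteq> cball c e"
    using dist_vec_le_of_mem_polydisc[of _ c "e / real CARD('m)"] by auto
  then show ?thesis using that[of "e / real CARD('m)"] e by auto
qed

text \<open>Induction over the released coordinates: each step applies the one-parameter extension
  in a new coordinate, and the induction hypothesis supplies the slice bounds on its boundary
  circle.\<close>

lemma psh_family_bounded_on_polydisc: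
  fixes D :: "(complex^'n) set" and G :: "(complex^'m) set"
    and \<U> :: "((complex^'n) \<times> (complex^'m) \<Rightarrow> ereal) set"
  assumes "open D" "open G"
    and psh: "\<And>u. u \<in> \<U> \<Longrightarrow> continuous_on (D \<times> G) u" "\<And>u. u \<in> \<U> \<Longrightarrow> psh_on (D \<times> G) u"
    and r: "r > 0" and R: "cball a R \<subseteq> D" and \<rho>: "\<rho> > 0" "polydisc w0 \<rho> \<subseteq> G"
    and small: "\<And>u z w. \<lbrakk>u \<in> \<U>; z \<in> cball a r; w \<in> polydisc w0 \<rho>\<rbrakk> \<Longrightarrow> u (z, w) \<le> ereal k0"
    and slices: "\<And>w. w \<in> polydisc w0 \<rho> \<Longrightarrow> \<exists>k::real. \<forall>u\<in>\<U>. \<forall>z\<in>cball a R. u (z, w) \<le> ereal k"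
    and "0 < R'" "R' < R"
  shows "\<exists>k::real. \<forall>u\<in>\<U>. \<forall>z\<in>cball a R'. \<forall>w\<in>polydisc w0 (\<rho> / 2). u (z, w) \<le> ereal k"
proof -
  txt \<open>The coordinates in \<open>I\<close> have already been released; the others are frozen at those of \<open>w'\<close>.\<close>
  define Q where "Q I w' = {w. (\<forall>i\<in>I. dist (w0 $ i) (w $ i) \<le> \<rho> / 2) \<and> (\<forall>i. i \<notin> I \<longrightarrow> w $ i = w' $ i)}"
    for I and w' :: "complex^'m"
  have bounded_on_Q: "\<exists>k::real. \<forall>u\<in>\<U>. \<forall>z\<in>cball a R'. \<forall>w\<in>Q I w'. u (z, w) \<le> ereal k"
    if "w' \<in> polydisc w0 \<rho>" "0 < R'" "R' < R" for I w' R'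
    using finite[of I] that
  proof (induction I arbitrary: w' R' rule: finite_induct)
    case empty
    obtain k :: real where k: "\<forall>u\<in>\<U>. \<forall>z\<in>cball a R. u (z, w') \<le> ereal k"
      using slices empty by blast
    have "Q {} w' = {w'}" by (auto simp: Q_def vec_eq_iff)
    then show ?case using k empty by (intro exI[of _ k]) auto
  next
    case (insert j I)
    \<comment> \<open>The induction hypothesis is spent at radius \<open>R1\<close>, which leaves
      room for the extension to lose radius down to \<open>R'\<close>.\<close>
    define R1 where "R1 = (R' + R) / 2"
    have R1: "0 < R1" "R' < R1" "R1 < R" using insert.prems by (auto simp: R1_def)
    \<comment> \<open>With this length, the unit disc in \<open>t\<close> sweeps the disc of radius
      \<open>\<rho>\<close> in coordinate \<open>j\<close>, and the half disc sweeps the wanted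
      radius \<open>\<rho> / 2\<close>.\<close>
    define b :: "complex^'m" where "b = axis j (of_real \<rho>)"
    have b: "b \<noteq> 0" using \<rho> by (simp add: b_def axis_eq_0_iff)
    define W where "W = {w. w $ j = w0 $ j \<and> (\<forall>i\<in>I. dist (w0 $ i) (w $ i) \<le> \<rho> / 2) \<and>
        (\<forall>i. i \<notin> insert j I \<longrightarrow> w $ i = w' $ i)}"
    \<comment> \<open>Letting the other coordinates range over \<open>W\<close> as part of the
      family makes the resulting bound uniform in them.\<close>
    define V where "V = (\<lambda>(u, w) z t. u (z, w + t *s b)) ` (\<U> \<times> W)"
    have in_P: "w + t *s b \<in> polydisc w0 \<rho>" if "w \<in> W" "t \<in> cball 0 1" for w t
      unfolding polydisc_def
    proof (intro CollectI allI)
      fix i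
      show "dist (w0 $ i) ((w + t *s b) $ i) \<le> \<rho>"
      proof (cases "i = j")
        case True
        then show ?thesis using that \<rho>
          by (simp add: W_def b_def axis_def dist_norm norm_mult mult_left_le_one_le)
      next
        case False
        then have "(w + t *s b) $ i = w $ i" by (simp add: b_def axis_def)
        moreover have "dist (w0 $ i) (w $ i) \<le> \<rho>"
        proof (cases "i \<in> I")
          case True
          then have "dist (w0 $ i) (w $ i) \<le> \<rho> / 2" using that by (simp add: W_def)
          then show ?thesis using \<rho> by linarith
        next
          case False
          then show ?thesis
            using \<open>i \<noteq> j\<close> that insert.prems(1) by (simp add: W_def polydisc_def)
        qed
        ultimately show ?thesis by (simp only:)
      qed
    qed
    \<comment> \<open>The small radius is taken as \<open>min r R1\<close> because \<open>r\<close>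
      may exceed \<open>R1\<close>.\<close>
    have "\<exists>k::real. \<forall>v\<in>V. \<forall>z\<in>cball a R'. \<forall>t\<in>cball 0 (1/2). v z t \<le> ereal k"
    proof (rule hartogs_family_extension[where r="min r R1" and R=R1 and ?k0.0=k0])
      show "0 < min r R1" "min r R1 \<le> R1" "0 < R'" "R' < R1" using r R1 insert.prems by auto
      show "v z t \<le> ereal k0" if v: "v \<in> V" "z \<in> cball a (min r R1)" "t \<in> sphere 0 1" for v z t
      proof -
        obtain u w where uw: "u \<in> \<U>" "w \<in> W" "v = (\<lambda>z t. u (z, w + t *s b))"
          using v(1) by (auto simp: V_def)
        then show ?thesis using small[of u z "w + t *s b"] in_P[of w t] v by auto
      qed
    next
      fix v assume "v \<in> V"
      then obtain u w where uw: "u \<in> \<U>" "w \<in> W" "v = (\<lambda>z t. u (z, w + t *s b))"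
        by (auto simp: V_def)
      have "continuous_on (cball a R1 \<times> cball 0 1) (\<lambda>p. u (fst p, w + snd p *s b))"
      proof (rule continuous_on_compose2[OF psh(1)[OF uw(1)]])
        show "continuous_on (cball a R1 \<times> cball 0 1) (\<lambda>p. (fst p, w + snd p *s b))"
          unfolding vector_scalar_mult_def by (intro continuous_intros)
        show "(\<lambda>p. (fst p, w + snd p *s b)) ` (cball a R1 \<times> cball 0 1) \<subseteq> D \<times> G"
          using in_P[OF uw(2)] \<rho> R R1 by fastforce
      qed
      then show "continuous_on (cball a R1 \<times> cball 0 1) (\<lambda>(z, t). v z t)"
        by (simp add: uw case_prod_unfold)
    next
      fix v \<phi> \<zeta> S k and t :: complex
      assume v: "v \<in> V" and S: "open S" "cball 0 1 \<subseteq> S" "\<phi> holomorphic_on S"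
        and le: "\<And>t. t \<in> cball 0 1 \<Longrightarrow> norm (\<phi> t *s \<zeta>) \<le> R1"
        and bd: "\<And>t. t \<in> sphere 0 1 \<Longrightarrow> v (a + \<phi> t *s \<zeta>) t \<le> ereal k"
        and t: "t \<in> cball 0 1"
      obtain u w where uw: "u \<in> \<U>" "w \<in> W" "v = (\<lambda>z t. u (z, w + t *s b))"
        using v by (auto simp: V_def)
      have "u (a + \<phi> t *s \<zeta>, w + t *s b) \<le> ereal k"
      proof (rule psh_graph_max_principle[OF _ psh(1)[OF uw(1)] psh(2)[OF uw(1)] S(3,1,2) b _ _ t])
        show "open (D \<times> G)" using assms by (intro open_Times)
        show "(a + \<phi> t *s \<zeta>, w + t *s b) \<in> D \<times> G" if "t \<in> cball 0 1" for t
        proof -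
          have "a + \<phi> t *s \<zeta> \<in> cball a R" using le[OF that] R1 by (simp add: dist_norm)
          then show ?thesis using in_P[OF uw(2) that] \<rho> R by blast
        qed
        show "u (a + \<phi> t *s \<zeta>, w + t *s b) \<le> ereal k" if "t \<in> sphere 0 1" for t
          using bd[OF that] by (simp add: uw)
      qed
      then show "v (a + \<phi> t *s \<zeta>) t \<le> ereal k" by (simp add: uw)
    next
      fix t :: complex assume t: "t \<in> sphere 0 1"
      \<comment> \<open>Frozen coordinates may lie anywhere in the polydisc of full radius
        \<open>\<rho>\<close>, so the induction hypothesis applies with coordinate \<open>j\<close>
        frozen on the boundary circle.\<close>
      define w'' where "w'' = (\<chi> i. if i = j then w0 $ j + t * of_real \<rho> else w' $ i)"
      have "w'' \<in> polydisc w0 \<rho>"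
        using insert.prems(1) t \<rho> by (auto simp: polydisc_def w''_def dist_norm norm_mult)
      from insert.IH[OF this R1(1,3)]
      obtain k :: real where k: "\<forall>u\<in>\<U>. \<forall>z\<in>cball a R1. \<forall>w\<in>Q I w''. u (z, w) \<le> ereal k" by blast
      have "w + t *s b \<in> Q I w''" if "w \<in> W" for w
        using that insert.hyps by (auto simp: Q_def W_def w''_def b_def axis_def)
      then show "\<exists>k::real. \<forall>v\<in>V. \<forall>z\<in>cball a R1. v z t \<le> ereal k"
        using k by (intro exI[of _ k]) (auto simp: V_def)
    qed
    then obtain k :: real where k: "\<And>v z t. \<lbrakk>v \<in> V; z \<in> cball a R'; t \<in> cball 0 (1/2)\<rbrakk> \<Longrightarrow> v z t \<le> ereal k"
      by blast
    have "u (z, w) \<le> ereal k" if u: "u \<in> \<U>" and z: "z \<in> cball a R'" and w: "w \<in> Q (insert j I) w'" for u z w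
    proof -
      define t where "t = (w $ j - w0 $ j) / of_real \<rho>"
      define w1 where "w1 = (\<chi> i. if i = j then w0 $ j else w $ i)"
      have "w1 \<in> W" using w insert.hyps by (auto simp: W_def w1_def Q_def)
      then have "(\<lambda>z t. u (z, w1 + t *s b)) \<in> V" using u by (force simp: V_def)
      moreover have "t \<in> cball 0 (1/2)"
        using w \<rho> by (auto simp: t_def Q_def norm_divide dist_norm norm_minus_commute field_simps)
      moreover have "w1 + t *s b = w"
        using \<rho> by (simp add: vec_eq_iff w1_def t_def b_def axis_def)
      ultimately show ?thesis using k[of "\<lambda>z t. u (z, w1 + t *s b)" z t] z by simp
    qed
    then show ?case by blast
  qed
  have "Q UNIV w0 = polydisc w0 (\<rho> / 2)" by (auto simp: Q_def polydisc_def)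
  moreover have "w0 \<in> polydisc w0 \<rho>" using \<rho> by (simp add: polydisc_def)
  ultimately show ?thesis
    using bounded_on_Q[of w0 R' UNIV] assms(11,12) by simp
qed

section \<open>Baire's theorem and the local bound\<close>

text \<open>Otherwise the complements of the sets \<open>E k\<close> would be relatively open and
  dense in the ball, while \<open>cover\<close> makes their intersection empty.\<close>

lemma Baire_interior_nonempty:
  fixes E :: "nat \<Rightarrow> 'a :: {real_normed_vector, heine_borel} set"
  assumes "e > 0" and closed: "\<And>k. closed (E k)" and cover: "cball x e \<subseteq> (\<Union>k. E k)"
  obtains k where "interior (E k) \<inter> cball x e \<noteq> {}"
proof (rule ccontr)
  assume "\<not> thesis"
  then have int: "interior (E k) \<inter> cball x e = {}" for k using that by blast
  have "cball x e \<subseteq> closure (\<Inter> (range (\<lambda>k. cball x e - E k)))"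
  proof (rule Baire)
    fix T assume "T \<in> range (\<lambda>k. cball x e - E k)"
    then obtain k where T: "T = cball x e - E k" by blast
    \<comment> \<open>Density is obtained first in the open ball, where closure can be moved past
      the intersection; taking closures then recovers the closed ball.\<close>
    have "ball x e \<subseteq> ball x e \<inter> closure (- E k)"
      using int[of k] by (auto simp: closure_complement)
    also have "\<dots> \<subseteq> closure (ball x e \<inter> - E k)"
      by (rule open_Int_closure_subset) simp
    also have "\<dots> \<subseteq> closure T"
      unfolding T by (rule closure_mono) auto
    finally have "closure (ball x e) \<subseteq> closure T"
      by (simp add: closure_minimal)
    moreover have "openin (top_of_set (cball x e)) T"
      unfolding T using closed[of k] by (auto simp: openin_open Diff_eq)
    ultimately show "openin (top_of_set (cball x e)) T \<and> cball x e \<subseteq> closure T"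
      using \<open>e > 0\<close> by simp
  qed auto
  moreover have "\<Inter> (range (\<lambda>k. cball x e - E k)) = {}" using cover by auto
  ultimately show False using \<open>e > 0\<close> by (simp only: closure_empty) simp
qed

text \<open>Baire's theorem gives no control over where the small ball lies except that its centre
  \<open>a\<close> is near \<open>z0\<close>. The enlarged ball about \<open>a\<close> must
  therefore reach back over \<open>z0\<close>, which is what the independence of its radius from
  \<open>r\<close> provides.\<close>

lemma psh_family_locally_bounded:
  fixes D :: "(complex^'n) set" and G :: "(complex^'m) set"
    and \<U> :: "((complex^'n) \<times> (complex^'m) \<Rightarrow> ereal) set"
  assumes "open D" "open G"
    and psh: "\<And>u. u \<in> \<U> \<Longrightarrow> continuous_on (D \<times> G) u" "\<And>u. u \<in> \<U> \<Longrightarrow> psh_on (D \<times> G) u"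
    and slice1: "\<And>w. w \<in> G \<Longrightarrow> loc_unif_bdd_above \<U> (D \<times> {w})"
    and slice2: "\<And>z. z \<in> D \<Longrightarrow> loc_unif_bdd_above \<U> ({z} \<times> G)"
    and p: "p \<in> D \<times> G"
  shows "\<exists>e k. e > 0 \<and> (\<forall>u\<in>\<U>. \<forall>q\<in>ball p e. u q \<le> ereal k)"
proof -
  obtain z0 w0 where p_eq: "p = (z0, w0)" and z0: "z0 \<in> D" and w0: "w0 \<in> G" using p by auto
  obtain e where e: "e > 0" "cball z0 e \<subseteq> D"
    using z0 assms open_contains_cball by blast
  \<comment> \<open>Radius \<open>2 * R\<close> about \<open>z0\<close> leaves room for radius
    \<open>R\<close> about any centre within \<open>R / 4\<close> of \<open>z0\<close>.\<close>
  define R where "R = e / 2"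
  have R: "R > 0" "cball z0 (2 * R) \<subseteq> D" using e by (auto simp: R_def)
  obtain \<rho> where \<rho>: "\<rho> > 0" "polydisc w0 \<rho> \<subseteq> G"
    using polydisc_subset_open[OF \<open>open G\<close> w0] by blast
  define E where "E k = {z \<in> cball z0 (2 * R). \<forall>u\<in>\<U>. \<forall>w\<in>polydisc w0 \<rho>. u (z, w) \<le> ereal (real k)}" for k :: nat
  have "closed (E k)" for k
  proof -
    have cl: "closed (cball z0 (2 * R) \<inter> (\<lambda>z. u (z, w)) -` {..ereal (real k)})"
      if "u \<in> \<U>" "w \<in> polydisc w0 \<rho>" for u w
    proof (intro continuous_closed_preimage)
      show "continuous_on (cball z0 (2 * R)) (\<lambda>z. u (z, w))"
        by (rule continuous_on_compose2[OF psh(1)[OF that(1)]])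
          (use that R \<rho> in \<open>auto intro!: continuous_intros\<close>)
    qed simp_all
    moreover have "E k = cball z0 (2 * R) \<inter>
        (\<Inter>u\<in>\<U>. \<Inter>w\<in>polydisc w0 \<rho>. cball z0 (2 * R) \<inter> (\<lambda>z. u (z, w)) -` {..ereal (real k)})"
      by (auto simp: E_def)
    ultimately show ?thesis by (simp only:) (intro closed_Int[OF closed_cball] closed_INT ballI cl)
  qed
  moreover have "cball z0 (R / 4) \<subseteq> (\<Union>k. E k)"
  proof
    fix z assume "z \<in> cball z0 (R / 4)"
    then have z: "z \<in> cball z0 (2 * R)" using R by auto
    then have "z \<in> D" using R by blast
    have "compact ({z} \<times> polydisc w0 \<rho>)" "{z} \<times> polydisc w0 \<rho> \<subseteq> {z} \<times> G"
      using \<rho> by (auto intro: compact_Times compact_polydisc)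
    then obtain c :: real where c: "\<forall>u\<in>\<U>. \<forall>x\<in>{z} \<times> polydisc w0 \<rho>. u x \<le> ereal c"
      using slice2[OF \<open>z \<in> D\<close>] unfolding loc_unif_bdd_above_def by blast
    obtain k :: nat where "c \<le> real k" using real_arch_simple by blast
    then have "z \<in> E k" using c z by (auto simp: E_def intro: le_ereal_trans)
    then show "z \<in> (\<Union>k. E k)" by blast
  qed
  ultimately obtain k0 where "interior (E k0) \<inter> cball z0 (R / 4) \<noteq> {}"
    using R(1) by (metis Baire_interior_nonempty[of "R / 4" E z0] divide_pos_pos zero_less_numeral)
  then obtain a where a: "a \<in> interior (E k0)" "dist z0 a \<le> R / 4" by auto
  then obtain r where r: "r > 0" "cball a r \<subseteq> E k0"
    by (meson interior_subset mem_interior_cball)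
  have "cball a R \<subseteq> cball z0 (2 * R)"
    using a(2) R by (intro cball_subset_cball_iff[THEN iffD2]) (auto simp: dist_commute)
  then have aR: "cball a R \<subseteq> D" using R by blast
  have "\<exists>k::real. \<forall>u\<in>\<U>. \<forall>z\<in>cball a (R / 2). \<forall>w\<in>polydisc w0 (\<rho> / 2). u (z, w) \<le> ereal k"
  proof (rule psh_family_bounded_on_polydisc[OF \<open>open D\<close> \<open>open G\<close> psh r(1) aR \<rho>])
    show "u (z, w) \<le> ereal (real k0)" if "u \<in> \<U>" "z \<in> cball a r" "w \<in> polydisc w0 \<rho>" for u z w
      using that r by (auto simp: E_def)
    show "\<exists>k::real. \<forall>u\<in>\<U>. \<forall>z\<in>cball a R. u (z, w) \<le> ereal k" if w: "w \<in> polydisc w0 \<rho>" for w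
    proof -
      have "compact (cball a R \<times> {w})" "cball a R \<times> {w} \<subseteq> D \<times> {w}"
        using aR by (auto intro: compact_Times)
      then obtain k :: real where "\<forall>u\<in>\<U>. \<forall>x\<in>cball a R \<times> {w}. u x \<le> ereal k"
        using slice1[OF subsetD[OF \<rho>(2) w]] unfolding loc_unif_bdd_above_def by metis
      then show ?thesis by auto
    qed
  qed (use R in auto)
  then obtain k :: real
    where k: "\<And>u z w. \<lbrakk>u \<in> \<U>; z \<in> cball a (R / 2); w \<in> polydisc w0 (\<rho> / 2)\<rbrakk> \<Longrightarrow> u (z, w) \<le> ereal k"
    by blast
  \<comment> \<open>Here \<open>R / 4\<close> for the shift of the centre and \<open>R / 4\<close>
    for the distance of \<open>q\<close> add up to the radius \<open>R / 2\<close> of the enlarged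
    ball.\<close>
  have "u q \<le> ereal k" if u: "u \<in> \<U>" and q: "q \<in> ball p (min (R / 4) (\<rho> / 2))" for u q
  proof -
    have "dist z0 (fst q) \<le> R / 4" "dist w0 (snd q) \<le> \<rho> / 2"
      using q dist_fst_le[of p q] dist_snd_le[of p q] by (auto simp: p_eq)
    moreover have "dist a (fst q) \<le> dist z0 a + dist z0 (fst q)"
      by (metis dist_commute dist_triangle)
    moreover have "dist (w0 $ i) (snd q $ i) \<le> dist w0 (snd q)" for i
      by (rule dist_vec_nth_le)
    then have "dist (w0 $ i) (snd q $ i) \<le> \<rho> / 2" for i
      using \<open>dist w0 (snd q) \<le> \<rho> / 2\<close> order_trans by blast
    ultimately have "fst q \<in> cball a (R / 2)" "snd q \<in> polydisc w0 (\<rho> / 2)"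
      using a(2) unfolding polydisc_def by auto
    then show ?thesis using k[OF u, of "fst q" "snd q"] by simp
  qed
  then show ?thesis using R \<rho> by (intro exI[of _ "min (R / 4) (\<rho> / 2)"] exI[of _ k]) auto
qed

theorem theorem1p1:
  fixes D :: "(complex^'n) set" and G :: "(complex^'m) set"
    and \<U> :: "((complex^'n) \<times> (complex^'m) \<Rightarrow> ereal) set"
  assumes "open D" and "connected D" and "open G" and "connected G"
    and "\<forall>u\<in>\<U>. continuous_on (D \<times> G) u \<and> psh_on (D \<times> G) u"
    and "\<forall>w\<in>G. loc_unif_bdd_above \<U> (D \<times> {w})"
    and "\<forall>z\<in>D. loc_unif_bdd_above \<U> ({z} \<times> G)"
  shows "loc_unif_bdd_above \<U> (D \<times> G)"
  unfolding loc_unif_bdd_above_def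
proof (intro allI impI)
  fix C assume C: "compact C" "C \<subseteq> D \<times> G"
  have "\<exists>e k. e > 0 \<and> (\<forall>u\<in>\<U>. \<forall>q\<in>ball p e. u q \<le> ereal k)" if "p \<in> C" for p
    by (rule psh_family_locally_bounded[OF assms(1,3)]) (use assms that C in auto)
  then obtain e k where e: "\<And>p. p \<in> C \<Longrightarrow> e p > 0"
    and k: "\<And>p u q. \<lbrakk>p \<in> C; u \<in> \<U>; q \<in> ball p (e p)\<rbrakk> \<Longrightarrow> u q \<le> ereal (k p)"
    by metis
  have "C \<subseteq> (\<Union>p\<in>C. ball p (e p))" using e by force
  then obtain C' where C': "C' \<subseteq> C" "finite C'" "C \<subseteq> (\<Union>p\<in>C'. ball p (e p))"
    using compactE_image[OF C(1), of C "\<lambda>p. ball p (e p)"] by auto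
  \<comment> \<open>If \<open>C'\<close> is empty then so is \<open>C\<close>, and the value of
    \<open>Max\<close> on the empty set is harmless.\<close>
  have "u x \<le> ereal (Max (k ` C'))" if u: "u \<in> \<U>" and x: "x \<in> C" for u x
  proof -
    obtain p where p: "p \<in> C'" "x \<in> ball p (e p)" using C' x by blast
    then have "u x \<le> ereal (k p)" using k C' u by blast
    also have "\<dots> \<le> ereal (Max (k ` C'))" using p C' by simp
    finally show ?thesis .
  qed
  then show "\<exists>c::real. \<forall>u\<in>\<U>. \<forall>x\<in>C. u x \<le> ereal c" by blast
qed

end
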